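(* Let $m,n\geq 2$ be integers with $m\equiv n \pmod 2$ and $m\neq n$. Then $\chi_{la}(K_{1,m,n})=3$.
   Context: All graphs are simple and finite. Let $G=(V,E)$ be a graph without isolated vertices. For a bijection $f:E\to\{1,2,\dots,|E|\}$ and a vertex $u$, the weight of $u$ is $w(u)=\sum_{e\in E(u)}f(e)$, where $E(u)$ is the set of edges incident to $u$. The bijection $f$ is a local antimagic labeling of $G$ if $w(u)\neq w(v)$ for every edge $uv\in E$; it then induces a proper vertex coloring of $G$ in which $v$ gets color $w(v)$. The local antimagic chromatic number $\chi_{la}(G)$ is the minimum number of distinct colors (distinct values of $w$) over all local antimagic labelings of $G$. $K_{1,m,n}$ is the complete tripartite graph with parts of sizes $1$, $m$ and $n$. *)

theory Defs
  imports "HOL-Library.Extended_Nat" "HOL-Number_Theory.Cong"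
begin

text \<open>A graph is given by its vertex set and its edge set; edges are two-element sets of vertices.\<close>

definition simple_graph :: "'a set \<Rightarrow> 'a set set \<Rightarrow> bool" where
  "simple_graph V E \<longleftrightarrow> finite V \<and> (\<forall>e\<in>E. e \<subseteq> V \<and> card e = 2)"

definition no_isolated_vertices :: "'a set \<Rightarrow> 'a set set \<Rightarrow> bool" where
  "no_isolated_vertices V E \<longleftrightarrow> (\<forall>v\<in>V. \<exists>e\<in>E. v \<in> e)"

definition incident_edges :: "'a set set \<Rightarrow> 'a \<Rightarrow> 'a set set" where
  "incident_edges E u = {e \<in> E. u \<in> e}"

definition weight :: "'a set set \<Rightarrow> ('a set \<Rightarrow> nat) \<Rightarrow> 'a \<Rightarrow> nat" where
  "weight E f u = (\<Sum>e\<in>incident_edges E u. f e)"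

definition local_antimagic_labeling :: "'a set set \<Rightarrow> ('a set \<Rightarrow> nat) \<Rightarrow> bool" where
  "local_antimagic_labeling E f \<longleftrightarrow>
     bij_betw f E {1..card E} \<and> (\<forall>u v. {u, v} \<in> E \<longrightarrow> weight E f u \<noteq> weight E f v)"

text \<open>
  The infimum is taken in \<^typ>\<open>enat\<close>: it is attained whenever some local antimagic labeling exists,
  and it is \<^term>\<open>\<infinity> :: enat\<close> otherwise. A finite value thus includes the existence of a labeling.
\<close>

definition chi_la :: "'a set \<Rightarrow> 'a set set \<Rightarrow> enat" where
  "chi_la V E = (INF f \<in> {f. local_antimagic_labeling E f}. enat (card (weight E f ` V)))"

text \<open>\<open>complete_tripartite l m n V E\<close>: the graph \<open>(V, E)\<close> is (a copy of) \<open>K\<^bsub>l,m,n\<^esub>\<close>.\<close>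

definition complete_tripartite :: "nat \<Rightarrow> nat \<Rightarrow> nat \<Rightarrow> 'a set \<Rightarrow> 'a set set \<Rightarrow> bool" where
  "complete_tripartite l m n V E \<longleftrightarrow>
     (\<exists>A B C. finite A \<and> finite B \<and> finite C \<and> card A = l \<and> card B = m \<and> card C = n \<and>
        A \<inter> B = {} \<and> A \<inter> C = {} \<and> B \<inter> C = {} \<and> V = A \<union> B \<union> C \<and>
        E = {{u, v} | u v. u \<in> A \<and> v \<in> B \<or> u \<in> A \<and> v \<in> C \<or> u \<in> B \<and> v \<in> C})"

lemma complete_tripartite_simple_graph:
  assumes "complete_tripartite l m n V E"
  shows "simple_graph V E"
proof -
  obtain A B C where fin: "finite A" "finite B" "finite C"
    and disj: "A \<inter> B = {}" "A \<inter> C = {}" "B \<inter> C = {}" and V: "V = A \<union> B \<union> C"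
    and E: "E = {{u, v} | u v. u \<in> A \<and> v \<in> B \<or> u \<in> A \<and> v \<in> C \<or> u \<in> B \<and> v \<in> C}"
    using assms unfolding complete_tripartite_def by (elim exE conjE)
  have "e \<subseteq> V \<and> card e = 2" if e: "e \<in> E" for e
  proof -
    obtain u v where uv: "e = {u, v}" "u \<in> A \<and> v \<in> B \<or> u \<in> A \<and> v \<in> C \<or> u \<in> B \<and> v \<in> C"
      using e unfolding E mem_Collect_eq by (elim exE conjE)
    then have "u \<noteq> v" "e \<subseteq> V" using disj V by auto
    then show ?thesis using uv(1) by simp
  qed
  then show ?thesis using fin V by (simp add: simple_graph_def)
qed

lemma complete_tripartite_no_isolated_vertices:
  assumes "complete_tripartite l m n V E" "l \<ge> 1" "m \<ge> 1"
  shows "no_isolated_vertices V E"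
proof -
  obtain A B C where *: "card A = l" "card B = m" "V = A \<union> B \<union> C"
    "E = {{u, v} | u v. u \<in> A \<and> v \<in> B \<or> u \<in> A \<and> v \<in> C \<or> u \<in> B \<and> v \<in> C}"
    using assms(1) unfolding complete_tripartite_def by blast
  have "A \<noteq> {}" "B \<noteq> {}" using * assms(2,3) by auto
  then obtain a b where ab: "a \<in> A" "b \<in> B" by blast
  have "\<exists>e\<in>E. v \<in> e" if v: "v \<in> V" for v
  proof -
    consider "v \<in> A" | "v \<in> B" | "v \<in> C" using v *(3) by blast
    then show ?thesis
    proof cases
      case 1
      then have "{v, b} \<in> E" using * ab by blast
      then show ?thesis by blast
    next
      case 2
      then have "{a, v} \<in> E" using * ab by blast
      then show ?thesis by blast
    next
      case 3
      then have "{a, v} \<in> E" using * ab by blast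
      then show ?thesis by blast
    qed
  qed
  then show ?thesis unfolding no_isolated_vertices_def by blast
qed

lemma complete_tripartite_exists: "\<exists>(V :: nat set) E. complete_tripartite l m n V E"
proof -
  have "complete_tripartite l m n ({0..<l} \<union> {l..<l+m} \<union> {l+m..<l+m+n})
      {{u, v} | u v. u \<in> {0..<l} \<and> v \<in> {l..<l+m} \<or> u \<in> {0..<l} \<and> v \<in> {l+m..<l+m+n} \<or>
        u \<in> {l..<l+m} \<and> v \<in> {l+m..<l+m+n}}"
    unfolding complete_tripartite_def
    by (rule exI[of _ "{0..<l}"], rule exI[of _ "{l..<l+m}"], rule exI[of _ "{l+m..<l+m+n}"]) auto
  then show ?thesis by blast
qed

lemma chi_la_attained:
  assumes "local_antimagic_labeling E f"
  shows "\<exists>g. local_antimagic_labeling E g \<and> chi_la V E = enat (card (weight E g ` V))"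
proof -
  let ?S = "(\<lambda>f. enat (card (weight E f ` V))) ` {f. local_antimagic_labeling E f}"
  have "?S \<noteq> {}" using assms by blast
  then have "Inf ?S \<in> ?S" by (simp add: Inf_enat_def del: image_is_empty) (meson LeastI ex_in_conv)
  then show ?thesis unfolding chi_la_def by auto
qed

end

theory Submission
  imports Defs
begin

text \<open>
  The edges of \<open>K\<^bsub>1,m,n\<^esub>\<close> with centre \<open>a\<close> and parts \<open>B\<close>, \<open>C\<close> are the cells, apart from \<open>(a, a)\<close>, of
  a rectangle with rows \<open>{a} \<union> B\<close> and columns \<open>{a} \<union> C\<close>. Filling it with a magic rectangle on the
  labels \<open>0, \<dots>, (m + 1) (n + 1) - 1\<close> whose entry \<open>0\<close> sits in the cell \<open>(a, a)\<close> gives every vertex of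
  \<open>B\<close> the row sum, every vertex of \<open>C\<close> the column sum, and \<open>a\<close> the sum of the two. These are three
  different values because \<open>m \<noteq> n\<close>, and fewer are impossible since the graph contains triangles.

  A magic \<open>p \<times> q\<close> rectangle is assembled, after centring the labels at \<open>0\<close>, from pieces all of whose
  rows and columns sum to \<open>0\<close>. When \<open>p\<close> and \<open>q\<close> are even, \<open>2 \<times> 4\<close> and \<open>2 \<times> 6\<close> pieces suffice. When
  \<open>p = 2 r + 3 < q = 2 n + 1\<close> are odd, three rows are built from columns \<open>(-b, w + b, -w)\<close> and their
  negatives, where the pairs \<open>w, w + b\<close> are nested in two runs of consecutive integers (one run for
  the even and one for the odd differences \<open>b\<close>). Each remaining pair of rows consists of columns
  \<open>(x, -x)\<close>, where \<open>\<bar>x\<bar>\<close> ranges over a run of \<open>2 n\<close> integers and one small integer of the parity of \<open>n\<close>.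
\<close>

section \<open>Zero-sum arrays\<close>

text \<open>
  Only the occurrence of the values is recorded. If \<open>A\<close> is large enough, the entries are distinct by
  counting, so no disjointness has to be tracked when arrays are glued together.
\<close>

definition zero_sum_array :: "nat \<Rightarrow> nat \<Rightarrow> int set \<Rightarrow> bool" where
  "zero_sum_array p q A \<longleftrightarrow> (\<exists>M :: nat \<Rightarrow> nat \<Rightarrow> int.
     (\<forall>i<p. (\<Sum>j<q. M i j) = 0) \<and> (\<forall>j<q. (\<Sum>i<p. M i j) = 0) \<and>
     (\<forall>x. \<bar>x\<bar> \<in> A \<longrightarrow> (\<exists>i<p. \<exists>j<q. M i j = x)))"

section \<open>Transposing and gluing arrays, and arrays given by explicit rows\<close>

lemma zero_sum_array_mono:
  "zero_sum_array p q A \<Longrightarrow> B \<subseteq> A \<Longrightarrow> zero_sum_array p q B"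
  unfolding zero_sum_array_def by blast

lemma zero_sum_array_transpose:
  assumes "zero_sum_array p q A" shows "zero_sum_array q p A"
proof -
  obtain M where "\<forall>i<p. (\<Sum>j<q. M i j) = 0" "\<forall>j<q. (\<Sum>i<p. M i j) = 0"
    "\<forall>x. \<bar>x\<bar> \<in> A \<longrightarrow> (\<exists>i<p. \<exists>j<q. M i j = x)"
    using assms unfolding zero_sum_array_def by blast
  then show ?thesis
    unfolding zero_sum_array_def by (intro exI[of _ "\<lambda>i j. M j i"]) blast
qed

lemma sum_lessThan_add:
  fixes f :: "nat \<Rightarrow> 'a :: comm_monoid_add"
  shows "(\<Sum>i<m + n. f i) = (\<Sum>i<m. f i) + (\<Sum>i<n. f (m + i))"
  by (induction n) (auto simp: add.assoc)

lemma zero_sum_array_vstack: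
  assumes "zero_sum_array p q A" "zero_sum_array p' q B"
  shows "zero_sum_array (p + p') q (A \<union> B)"
proof -
  obtain M where M: "\<forall>i<p. (\<Sum>j<q. M i j) = 0" "\<forall>j<q. (\<Sum>i<p. M i j) = 0"
    "\<forall>x. \<bar>x\<bar> \<in> A \<longrightarrow> (\<exists>i<p. \<exists>j<q. M i j = x)"
    using assms(1) unfolding zero_sum_array_def by blast
  obtain M' where M': "\<forall>i<p'. (\<Sum>j<q. M' i j) = 0" "\<forall>j<q. (\<Sum>i<p'. M' i j) = 0"
    "\<forall>x. \<bar>x\<bar> \<in> B \<longrightarrow> (\<exists>i<p'. \<exists>j<q. M' i j = x)"
    using assms(2) unfolding zero_sum_array_def by blast
  define N where "N i j = (if i < p then M i j else M' (i - p) j)" for i j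
  have "\<exists>i<p + p'. \<exists>j<q. N i j = x" if x: "\<bar>x\<bar> \<in> A \<union> B" for x
  proof (cases "\<bar>x\<bar> \<in> A")
    case True
    then obtain i j where "i < p" "j < q" "M i j = x" using M(3) by blast
    then show ?thesis by (intro exI[of _ i]) (auto simp: N_def)
  next
    case False
    then obtain i j where "i < p'" "j < q" "M' i j = x" using M'(3) x by blast
    then show ?thesis by (intro exI[of _ "p + i"]) (auto simp: N_def)
  qed
  moreover have "(\<Sum>j<q. N i j) = 0" if "i < p + p'" for i
    using that M(1) M'(1) by (cases "i < p") (auto simp: N_def)
  moreover have "(\<Sum>i<p + p'. N i j) = 0" if "j < q" for j
    using that M(2) M'(2) by (simp add: sum_lessThan_add N_def)
  ultimately show ?thesis unfolding zero_sum_array_def by blast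
qed

lemma zero_sum_array_hstack:
  assumes "zero_sum_array p q A" "zero_sum_array p q' B"
  shows "zero_sum_array p (q + q') (A \<union> B)"
  using assms by (meson zero_sum_array_transpose zero_sum_array_vstack)

lemma zero_sum_array_hstack_UN:
  assumes "\<And>k. k < n \<Longrightarrow> zero_sum_array p q (A k)"
  shows "zero_sum_array p (n * q) (\<Union>k<n. A k)"
  using assms
proof (induction n)
  case 0
  show ?case by (simp add: zero_sum_array_def)
next
  case (Suc n)
  then have "zero_sum_array p (n * q + q) ((\<Union>k<n. A k) \<union> A n)"
    by (intro zero_sum_array_hstack) auto
  then show ?case by (simp add: lessThan_Suc Un_commute add.commute)
qed

lemma zero_sum_array_vstack_UN:
  assumes "\<And>k. k < n \<Longrightarrow> zero_sum_array p q (A k)"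
  shows "zero_sum_array (n * p) q (\<Union>k<n. A k)"
  using assms by (meson zero_sum_array_transpose zero_sum_array_hstack_UN)

text \<open>Interface for concrete matrices: rows and column indices range over lists, so
  simplification can evaluate the sums. Both \<open>x\<close> and \<open>- x\<close> must occur
  because \<open>A\<close> records absolute values.\<close>

lemma zero_sum_array_rows:
  assumes "length R = p" "\<forall>r\<in>set R. length r = q \<and> sum_list r = 0"
    "\<forall>j\<in>set [0..<q]. (\<Sum>r\<leftarrow>R. r ! j) = 0"
    "\<forall>x\<in>A. x \<in> \<Union> (set ` set R) \<and> - x \<in> \<Union> (set ` set R)"
  shows "zero_sum_array p q A"
proof -
  have "\<exists>i<p. \<exists>j<q. R ! i ! j = x" if "\<bar>x\<bar> \<in> A" for x
  proof -
    have "x \<in> \<Union> (set ` set R)"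
      using assms(4) that by (metis abs_if minus_minus)
    then obtain r where "r \<in> set R" "x \<in> set r" by blast
    then show ?thesis using assms(1,2) by (metis in_set_conv_nth)
  qed
  moreover have "(\<Sum>j<q. R ! i ! j) = 0" if "i < p" for i
    using assms(1,2) that nth_mem[of i R] sum_list_sum_nth[of "R ! i"]
    by (auto simp: atLeast0LessThan)
  moreover have "(\<Sum>i<p. R ! i ! j) = 0" if "j < q" for j
    using assms(1,3) that by (simp add: sum_list_sum_nth atLeast0LessThan)
  ultimately show ?thesis
    unfolding zero_sum_array_def by (intro exI[of _ "\<lambda>i j. R ! i ! j"]) blast
qed

section \<open>Two-row strips with prescribed absolute values\<close>

lemma zero_sum_array_strip:
  fixes v :: "nat \<Rightarrow> int"
  assumes "(\<Sum>j<q. v j) = 0"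
  shows "zero_sum_array 2 q ((\<lambda>j. \<bar>v j\<bar>) ` {..<q})"
proof -
  define M where "M i j = (if i = 0 then v j else - v j)" for i j :: nat
  have "\<exists>i<2. \<exists>j<q. M i j = x" if x: "\<bar>x\<bar> \<in> (\<lambda>j. \<bar>v j\<bar>) ` {..<q}" for x
  proof -
    obtain j where j: "j < q" "\<bar>x\<bar> = \<bar>v j\<bar>" using x by auto
    then have "M 0 j = x \<or> M 1 j = x" by (auto simp: M_def)
    then show ?thesis using j(1) by (metis one_less_numeral_iff pos2 semiring_norm(76))
  qed
  then show ?thesis
    unfolding zero_sum_array_def using assms
    by (intro exI[of _ M]) (auto simp: M_def numeral_2_eq_2 less_Suc_eq sum_negf)
qed

text \<open>The parity of \<open>c\<close> is forced: modulo 2 the weighted sum is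
  \<open>0 + 1 + ... + (2 * n - 1) = n * (2 * n - 1)\<close>, hence \<open>n\<close>. The induction
  adds four signs at a time; a block of four signs with sum 0 contributes -4, -2, 0, 2 or 4,
  wherever it starts.\<close>

lemma balanced_signs:
  fixes c :: int
  assumes "\<bar>c\<bar> \<le> 2 * int n" "even (c - int n)"
  shows "\<exists>e :: nat \<Rightarrow> int. (\<forall>i. \<bar>e i\<bar> = 1) \<and> (\<Sum>i<2 * n. e i) = 0 \<and> (\<Sum>i<2 * n. e i * int i) = c"
  using assms
proof (induction n arbitrary: c rule: nat_induct2)
  case 0
  then show ?case by (intro exI[of _ "\<lambda>_. 1"]) simp
next
  case 1
  then have "c = 1 \<or> c = -1" by presburger
  then show ?case
    by (intro exI[of _ "\<lambda>i. if i = 0 then - c else c"]) (auto simp: numeral_2_eq_2)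
next
  case (step n)
  \<comment> \<open>For \<open>n > 0\<close> the values 4, 0 and -4 suffice to bring
    \<open>c - d\<close> into range. For \<open>n = 0\<close> nothing may remain, so
    \<open>d\<close> is \<open>c\<close> itself, possibly 2 or -2.\<close>
  have ex: "\<exists>d. \<bar>c - d\<bar> \<le> 2 * int n \<and> d \<in> {-4, -2, 0, 2, 4}"
  proof (cases "n = 0")
    case True
    then have "\<bar>c\<bar> \<le> 4" "even c" using step.prems by auto
    then have "c \<in> {-4, -2, 0, 2, 4}" by simp presburger
    then show ?thesis by (intro exI[of _ c]) simp
  next
    case False
    then show ?thesis using step.prems
      by (intro exI[of _ "if c \<ge> 3 then 4 else if c \<le> -3 then -4 else 0"]) auto
  qed
  then obtain d where d: "\<bar>c - d\<bar> \<le> 2 * int n" "d \<in> {-4, -2, 0, 2, 4}" by blast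
  have "even (c - d - int n)" using d(2) step.prems(2) by auto
  then obtain e where e: "\<forall>i. \<bar>e i\<bar> = 1" "(\<Sum>i<2 * n. e i) = 0"
    "(\<Sum>i<2 * n. e i * int i) = c - d"
    using step.IH[of "c - d"] d(1) by auto
  define l :: "int list" where "l = (if d = 4 then [-1,-1,1,1] else if d = 2 then [-1,1,-1,1]
    else if d = 0 then [1,-1,-1,1] else if d = -2 then [1,-1,1,-1] else [1,1,-1,-1])"
  define h where "h i = (if i < 2 * n then e i else if i < 2 * n + 4 then l ! (i - 2 * n) else 1)" for i
  have l: "\<bar>l ! i\<bar> = 1" if "i < 4" for i
  proof -
    have "i \<in> {0, 1, 2, 3}" using that by auto
    then show ?thesis unfolding l_def by auto
  qed
  have four: "(\<Sum>i<4. f i) = f 0 + f 1 + f 2 + f 3" for f :: "nat \<Rightarrow> int"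
    by (simp add: eval_nat_numeral)
  have eq: "2 * (n + 2) = 2 * n + 4" by simp
  have "\<bar>h i\<bar> = 1" for i
    using l[of "i - 2 * n"] e(1) by (auto simp: h_def)
  moreover have "(\<Sum>i<2 * (n + 2). h i) = 0"
    unfolding eq sum_lessThan_add four using e(2) d(2)
    by (auto simp: h_def l_def)
  moreover have "(\<Sum>i<2 * (n + 2). h i * int i) = c"
    unfolding eq sum_lessThan_add four using e(3) d(2)
    by (auto simp: h_def l_def)
  ultimately show ?case by blast
qed

text \<open>The signs on the run sum to 0, so its offset \<open>u + 1\<close> cancels. What remains
  is the weighted sum from \<open>balanced_signs\<close>, chosen equal to \<open>a\<close> and
  cancelled by a last entry \<open>- a\<close>.\<close>

lemma zero_sum_array_run:
  fixes a u :: int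
  assumes "0 \<le> a" "a \<le> 2 * int n" "even (a - int n)" "0 \<le> u"
  shows "zero_sum_array 2 (2 * n + 1) (insert a {u<..u + 2 * int n})"
proof -
  obtain e :: "nat \<Rightarrow> int" where e: "\<forall>i. \<bar>e i\<bar> = 1" "(\<Sum>i<2 * n. e i) = 0"
    "(\<Sum>i<2 * n. e i * int i) = a"
    using balanced_signs[of a n] assms by auto
  define v where "v j = (if j < 2 * n then e j * (u + 1 + int j) else - a)" for j
  have "(\<Sum>j<2 * n + 1. v j) = (\<Sum>j<2 * n. e j * (u + 1 + int j)) - a"
    by (simp add: v_def)
  also have "\<dots> = (u + 1) * (\<Sum>j<2 * n. e j) + (\<Sum>j<2 * n. e j * int j) - a"
    by (simp add: sum.distrib sum_distrib_left algebra_simps)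
  finally have "zero_sum_array 2 (2 * n + 1) ((\<lambda>j. \<bar>v j\<bar>) ` {..<2 * n + 1})"
    using e(2,3) by (intro zero_sum_array_strip) simp
  moreover have "insert a {u<..u + 2 * int n} \<subseteq> (\<lambda>j. \<bar>v j\<bar>) ` {..<2 * n + 1}"
  proof -
    have "x \<in> (\<lambda>j. \<bar>v j\<bar>) ` {..<2 * n + 1}" if x: "u < x" "x \<le> u + 2 * int n" for x
      using x assms(4) e(1)
      by (intro image_eqI[of _ _ "nat (x - u - 1)"]) (auto simp: v_def abs_mult)
    moreover have "a \<in> (\<lambda>j. \<bar>v j\<bar>) ` {..<2 * n + 1}"
      using assms(1) by (intro image_eqI[of _ _ "2 * n"]) (auto simp: v_def)
    ultimately show ?thesis by auto
  qed
  ultimately show ?thesis by (rule zero_sum_array_mono)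
qed

section \<open>Three-row pieces\<close>

lemma zero_sum_array_triples:
  "zero_sum_array 3 (2 * n) (\<Union>k<n. {b k, w k, w k + b k})"
proof -
  have "zero_sum_array 3 2 {b k, w k, w k + b k}" for k
    by (rule zero_sum_array_rows[of "[[- b k, b k], [w k + b k, - (w k + b k)], [- w k, w k]]"])
      (auto simp: upt_rec numeral_nat)
  then show ?thesis using zero_sum_array_hstack_UN[of n 3 2] by (simp add: mult.commute)
qed

text \<open>
  The column with a zero entry spoils the row sums of an array made of triples. Each of the next two
  pieces combines that column with three triples whose entries are permuted vertically.
\<close>

lemma zero_sum_array_3_7_a:
  "zero_sum_array 3 7 {0, 1, 2, 3, c - 1, c, c + 1, d, d + 1, d + 2, d + 3}"
  by (rule zero_sum_array_rows[of "[
    [2, c, 1 - c, d + 2, 1, -3, - d - 3],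
    [c - 1, - c, -2, -1, d + 1, - d, 3],
    [- c - 1, 0, c + 1, - d - 1, - d - 2, d + 3, d]]"]) (auto simp: upt_rec)

lemma zero_sum_array_3_7_b:
  "zero_sum_array 3 7 {0, 2, 4, 6, c - 3, c - 2, c - 1, c, c + 1, c + 2, c + 3}"
  by (rule zero_sum_array_rows[of "[
    [6, c - 2, c - 1, - c, -2, -4, 3 - c],
    [c - 3, 4, 2, c, 1 - c, 2 - c, -6],
    [- c - 3, - c - 2, - c - 1, 0, c + 1, c + 2, c + 3]]"]) (auto simp: upt_rec)

section \<open>Even side lengths\<close>

text \<open>With an even number of cells, twice the centred labels are odd numbers, and
  \<open>odds 0 (p * q div 2)\<close> holds their absolute values. The offset \<open>u\<close> lets
  a further piece continue where the previous one stopped.\<close>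

abbreviation odds :: "nat \<Rightarrow> nat \<Rightarrow> int set" where
  "odds u n \<equiv> (\<lambda>i. 2 * int i + 1) ` {u..<u + n}"

lemma odds_append: "odds u n \<union> odds (u + n) n' = odds u (n + n')"
  by (simp flip: image_Un add: ivl_disj_un_two(3) add.assoc)

text \<open>Four consecutive odd numbers balance because
  \<open>t + (t + 6) = (t + 2) + (t + 4)\<close>.\<close>

lemma zero_sum_array_2_mult_4: "zero_sum_array 2 (4 * x) (odds u (4 * x))"
proof (induction x)
  case 0
  show ?case by (simp add: zero_sum_array_def)
next
  case (Suc x)
  have "zero_sum_array 2 4 (odds (u + 4 * x) 4)"
    by (rule zero_sum_array_rows[of "let t = 2 * int (u + 4 * x) + 1 in
        [[t, - (t + 2), - (t + 4), t + 6], [- t, t + 2, t + 4, - (t + 6)]]"])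
      (auto simp: Let_def upt_rec eval_nat_numeral atLeastLessThanSuc)
  with Suc.IH have "zero_sum_array 2 (4 * x + 4) (odds u (4 * x) \<union> odds (u + 4 * x) 4)"
    by (rule zero_sum_array_hstack)
  also have "odds u (4 * x) \<union> odds (u + 4 * x) 4 = odds u (4 * Suc x)"
    unfolding odds_append by (simp add: add.commute)
  finally show ?case by (simp add: add.commute)
qed

lemma zero_sum_array_even_mult_4: "zero_sum_array (2 * y) (4 * x) (odds u (4 * x * y))"
proof (induction y)
  case 0
  show ?case by (simp add: zero_sum_array_def)
next
  case (Suc y)
  have "zero_sum_array (2 * y + 2) (4 * x) (odds u (4 * x * y) \<union> odds (u + 4 * x * y) (4 * x))"
    using Suc.IH zero_sum_array_2_mult_4 by (rule zero_sum_array_vstack)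
  also have "odds u (4 * x * y) \<union> odds (u + 4 * x * y) (4 * x) = odds u (4 * x * Suc y)"
    unfolding odds_append by (simp add: add.commute)
  finally show ?case by simp
qed

text \<open>Six consecutive odd numbers cannot be balanced three against three, as
  \<open>0 + 1 + ... + 5\<close> is odd. Hence the first strip uses the special identity
  \<open>1 + 3 + 5 + 9 = 7 + 11\<close>, and later strips come in pairs sharing twelve odd
  numbers.\<close>

lemma zero_sum_array_singly_even_6: "zero_sum_array (4 * y + 2) 6 (odds 0 (12 * y + 6))"
proof (induction y)
  case 0
  show ?case
    by (rule zero_sum_array_rows[of "[[1, 3, 5, -7, 9, -11], [-1, -3, -5, 7, -9, 11]]"])
      (auto simp: upt_rec eval_nat_numeral atLeastLessThanSuc)
next
  case (Suc y)
  have "zero_sum_array 4 6 (odds (12 * y + 6) 12)"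
    by (rule zero_sum_array_rows[of "let t = 2 * int (12 * y + 6) + 1 in
        [[t, t + 10, t + 22, - (t + 4), - (t + 8), - (t + 20)],
         [- t, - (t + 10), - (t + 22), t + 4, t + 8, t + 20],
         [t + 2, t + 14, t + 18, - (t + 6), - (t + 12), - (t + 16)],
         [- (t + 2), - (t + 14), - (t + 18), t + 6, t + 12, t + 16]]"])
      (auto simp: Let_def upt_rec eval_nat_numeral atLeastLessThanSuc)
  with Suc.IH have "zero_sum_array (4 * y + 2 + 4) 6 (odds 0 (12 * y + 6) \<union> odds (12 * y + 6) 12)"
    by (rule zero_sum_array_vstack)
  also have "odds 0 (12 * y + 6) \<union> odds (12 * y + 6) 12 = odds 0 (12 * Suc y + 6)"
    using odds_append[of 0 "12 * y + 6" 12] by (simp add: add.commute)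
  finally show ?case by (simp add: add.commute)
qed

text \<open>A side divisible by 4 is cut into pieces of length 4. If neither is, then
  \<open>q\<close> is 2 modulo 4 and at least 6, so six columns are split off and the remaining
  width is a multiple of 4.\<close>

lemma zero_sum_array_even:
  assumes "even p" "even q" "p > 2" "q > 2"
  shows "zero_sum_array p q (odds 0 (p * q div 2))"
proof -
  consider x where "q = 4 * x" | x where "p = 4 * x" | "p mod 4 = 2" "q mod 4 = 2"
  proof -
    have "4 dvd q \<or> 4 dvd p \<or> p mod 4 = 2 \<and> q mod 4 = 2" using assms by presburger
    then show ?thesis using that by (elim disjE dvdE) auto
  qed
  then show ?thesis
  proof cases
    case 1
    then show ?thesis
      using assms zero_sum_array_even_mult_4[of "p div 2" x 0] by (auto elim!: evenE simp: mult_ac)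
  next
    case 2
    then show ?thesis
      using assms zero_sum_array_transpose[OF zero_sum_array_even_mult_4[of "q div 2" x 0]]
      by (auto elim!: evenE simp: mult_ac)
  next
    case 3
    define y where "y = p div 4"
    define x where "x = (q - 6) div 4"
    have p: "p = 4 * y + 2" using 3 unfolding y_def by presburger
    have q: "q = 6 + 4 * x" using 3 assms(4) unfolding x_def by presburger
    have "zero_sum_array p (6 + 4 * x)
        (odds 0 (12 * y + 6) \<union> odds (12 * y + 6) (4 * x * (2 * y + 1)))"
      using zero_sum_array_singly_even_6[of y] zero_sum_array_even_mult_4[of "2 * y + 1" x "12 * y + 6"]
      unfolding p by (intro zero_sum_array_hstack) simp_all
    also have "odds 0 (12 * y + 6) \<union> odds (12 * y + 6) (4 * x * (2 * y + 1)) = odds 0 (p * q div 2)"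
      unfolding p q using odds_append[of 0 "12 * y + 6" "4 * x * (2 * y + 1)"]
      by (simp add: algebra_simps)
    finally show ?thesis unfolding q .
  qed
qed

section \<open>Odd side lengths\<close>

text \<open>
  The absolute values in the three base rows: the differences \<open>2, 4, \<dots>, 2 s\<close> and \<open>1, 3, \<dots>, 2 s' - 1\<close>,
  and above \<open>l\<close> a run of length \<open>2 s + 1\<close> holding the pairs with even differences followed by one of
  length \<open>2 s'\<close> holding those with odd differences.
\<close>

definition base_set :: "int \<Rightarrow> nat \<Rightarrow> nat \<Rightarrow> int set" where
  "base_set l s s' = {x. 0 \<le> x \<and> (even x \<and> x \<le> 2 * int s \<or> odd x \<and> x < 2 * int s' \<or>
     l < x \<and> x \<le> l + 2 * int s + 2 * int s' + 1)}"

text \<open>The special piece uses up the differences 1, 2 and 3 with their pairs, and puts the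
  middle \<open>c\<close> of the first run into the column with entry 0. All other differences are
  served by triples.\<close>

lemma zero_sum_array_base_1_2:
  assumes "1 \<le> s" "2 \<le> s'"
  shows "zero_sum_array 3 (2 * s + 2 * s' + 1) (base_set l s s')"
proof -
  \<comment> \<open>\<open>c\<close> is the middle of the run of length \<open>2 * s + 1\<close>,
    and \<open>d\<close> starts the upper half of the run of length \<open>2 * s'\<close>. Thus
    \<open>c - j, c + j\<close> differ by \<open>2 * j\<close>, and \<open>d - j - 1, d + j\<close>
    by \<open>2 * j + 1\<close>.\<close>
  define c where "c = l + int s + 1"
  define d where "d = l + 2 * int s + int s' + 2"
  define W where "W = {0, 1, 2, 3, c - 1, c, c + 1, d - 2, d - 1, d, d + 1}"
  define X where "X = (\<Union>k<s - 1. {2 * int k + 4, c - int k - 2, (c - int k - 2) + (2 * int k + 4)})"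
  define Y where "Y = (\<Union>k<s' - 2. {2 * int k + 5, d - int k - 3, (d - int k - 3) + (2 * int k + 5)})"
  have "zero_sum_array 3 7 W"
    using zero_sum_array_3_7_a[of c "d - 2"] by (simp add: W_def add.commute)
  then have "zero_sum_array 3 (7 + 2 * (s - 1) + 2 * (s' - 2)) (W \<union> X \<union> Y)"
    unfolding X_def Y_def by (intro zero_sum_array_hstack zero_sum_array_triples)
  moreover have "base_set l s s' \<subseteq> W \<union> X \<union> Y"
  proof
    fix x assume x: "x \<in> base_set l s s'"
    \<comment> \<open>A number outside \<open>W\<close> is the difference, the lower or the upper
      member of the pair with some index \<open>k\<close>; the arguments \<open>nat (...)\<close>
      below solve for this index.\<close>
    have X: "x \<in> X" if "k < s - 1" "x = 2 * int k + 4 \<or> x = c - int k - 2 \<or> x = c + int k + 2" for k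
      using that unfolding X_def by (intro UN_I[of k]) auto
    have Y: "x \<in> Y" if "k < s' - 2" "x = 2 * int k + 5 \<or> x = d - int k - 3 \<or> x = d + int k + 2" for k
      using that unfolding Y_def by (intro UN_I[of k]) auto
    consider "x \<in> W" | "even x" "4 \<le> x" "x \<le> 2 * int s" | "odd x" "5 \<le> x" "x < 2 * int s'"
      | "l < x" "x < c - 1" | "c + 1 < x" "x < d - int s'" | "d - int s' \<le> x" "x < d - 2"
      | "d + 1 < x" "x < d + int s'"
    proof -
      consider (e) "even x" "x \<le> 2 * int s" | (o) "odd x" "x < 2 * int s'" | (r) "l < x" "x < d + int s'"
        using x by (auto simp: base_set_def d_def)
      then show ?thesis
      proof cases
        case e
        then have "4 \<le> x \<or> x = 0 \<or> x = 2" using x unfolding base_set_def mem_Collect_eq by presburger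
        then show ?thesis using e that by (auto simp: W_def)
      next
        case o
        then have "5 \<le> x \<or> x = 1 \<or> x = 3" using x unfolding base_set_def mem_Collect_eq by presburger
        then show ?thesis using o that by (auto simp: W_def)
      next
        case r
        then consider "x < c - 1" | "c - 1 \<le> x" "x \<le> c + 1" | "c + 1 < x" "x < d - int s'"
          | "d - int s' \<le> x" "x < d - 2" | "d - 2 \<le> x" "x \<le> d + 1" | "d + 1 < x" by linarith
        then show ?thesis
        proof cases
          case 2
          then have "x = c - 1 \<or> x = c \<or> x = c + 1" by linarith
          then show ?thesis using that(1) unfolding W_def by blast
        next
          case 5
          then have "x = d - 2 \<or> x = d - 1 \<or> x = d \<or> x = d + 1" by linarith
          then show ?thesis using that(1) unfolding W_def by blast
        qed (use r that in blast)+
      qed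
    qed
    then show "x \<in> W \<union> X \<union> Y"
    proof cases
      case 2
      then show ?thesis using X[of "nat (x div 2 - 2)"] assms by auto
    next
      case 3
      then obtain k where k: "x = 2 * k + 1" by (elim oddE)
      show ?thesis using Y[of "nat (k - 2)"] 3 assms unfolding k by auto
    next
      case 4
      then show ?thesis using X[of "nat (c - x - 2)"] assms by (auto simp: c_def)
    next
      case 5
      then show ?thesis using X[of "nat (x - c - 2)"] assms by (auto simp: c_def d_def)
    next
      case 6
      then show ?thesis using Y[of "nat (d - x - 3)"] assms by (auto simp: d_def)
    next
      case 7
      then show ?thesis using Y[of "nat (x - d - 2)"] assms by (auto simp: d_def)
    qed simp
  qed
  ultimately show ?thesis
    using assms zero_sum_array_mono by (simp add: algebra_simps)
qed

text \<open>Counterpart for small \<open>s'\<close>: the special piece takes the differences 2, 4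
  and 6, all from the run around \<open>c\<close>, so the run around \<open>d\<close> may even be
  empty.\<close>

lemma zero_sum_array_base_3:
  assumes "3 \<le> s"
  shows "zero_sum_array 3 (2 * s + 2 * s' + 1) (base_set l s s')"
proof -
  define c where "c = l + int s + 1"
  define d where "d = l + 2 * int s + int s' + 2"
  define W where "W = {0, 2, 4, 6, c - 3, c - 2, c - 1, c, c + 1, c + 2, c + 3}"
  define X where "X = (\<Union>k<s - 3. {2 * int k + 8, c - int k - 4, (c - int k - 4) + (2 * int k + 8)})"
  define Y where "Y = (\<Union>k<s'. {2 * int k + 1, d - int k - 1, (d - int k - 1) + (2 * int k + 1)})"
  have "zero_sum_array 3 7 W"
    unfolding W_def by (rule zero_sum_array_3_7_b)
  then have "zero_sum_array 3 (7 + 2 * (s - 3) + 2 * s') (W \<union> X \<union> Y)"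
    unfolding X_def Y_def by (intro zero_sum_array_hstack zero_sum_array_triples)
  moreover have "base_set l s s' \<subseteq> W \<union> X \<union> Y"
  proof
    fix x assume x: "x \<in> base_set l s s'"
    have X: "x \<in> X" if "k < s - 3" "x = 2 * int k + 8 \<or> x = c - int k - 4 \<or> x = c + int k + 4" for k
      using that unfolding X_def by (intro UN_I[of k]) auto
    have Y: "x \<in> Y" if "k < s'" "x = 2 * int k + 1 \<or> x = d - int k - 1 \<or> x = d + int k" for k
      using that unfolding Y_def by (intro UN_I[of k]) auto
    consider "x \<in> W" | "even x" "8 \<le> x" "x \<le> 2 * int s" | "odd x" "1 \<le> x" "x < 2 * int s'"
      | "l < x" "x < c - 3" | "c + 3 < x" "x < d - int s'" | "d - int s' \<le> x" "x < d"
      | "d \<le> x" "x < d + int s'"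
    proof -
      consider (e) "even x" "x \<le> 2 * int s" | (o) "odd x" "x < 2 * int s'" | (r) "l < x" "x < d + int s'"
        using x by (auto simp: base_set_def d_def)
      then show ?thesis
      proof cases
        case e
        then have "8 \<le> x \<or> x = 0 \<or> x = 2 \<or> x = 4 \<or> x = 6"
          using x unfolding base_set_def mem_Collect_eq by presburger
        then show ?thesis using e that by (auto simp: W_def)
      next
        case o
        then have "1 \<le> x" using x unfolding base_set_def mem_Collect_eq by presburger
        then show ?thesis using o that by blast
      next
        case r
        then consider "x < c - 3" | "c - 3 \<le> x" "x \<le> c + 3" | "c + 3 < x" "x < d - int s'"
          | "d - int s' \<le> x" "x < d" | "d \<le> x" by linarith
        then show ?thesis
        proof cases
          case 2
          then have "x = c - 3 \<or> x = c - 2 \<or> x = c - 1 \<or> x = c \<or> x = c + 1 \<or> x = c + 2 \<or> x = c + 3"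
            by linarith
          then show ?thesis using that(1) unfolding W_def by blast
        qed (use r that in blast)+
      qed
    qed
    then show "x \<in> W \<union> X \<union> Y"
    proof cases
      case 2
      then show ?thesis using X[of "nat (x div 2 - 4)"] assms by auto
    next
      case 3
      then obtain k where k: "x = 2 * k + 1" by (elim oddE)
      show ?thesis using Y[of "nat k"] 3 unfolding k by auto
    next
      case 4
      then show ?thesis using X[of "nat (c - x - 4)"] assms by (auto simp: c_def)
    next
      case 5
      then show ?thesis using X[of "nat (x - c - 4)"] assms by (auto simp: c_def d_def)
    next
      case 6
      then show ?thesis using Y[of "nat (d - x - 1)"] assms by (auto simp: d_def)
    next
      case 7
      then show ?thesis using Y[of "nat (x - d)"] assms by (auto simp: d_def)
    qed simp
  qed
  ultimately show ?thesis
    using assms zero_sum_array_mono by (simp add: algebra_simps)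
qed

text \<open>An exceptional base escaping both families, for the 5 by 7 rectangle. The missing number
  3 goes to its single two-row strip.\<close>

lemma zero_sum_array_base_2_1: "zero_sum_array 3 7 (base_set 4 2 1)"
proof -
  have "zero_sum_array 3 7 (set [0, 1, 2, 4, 5, 6, 7, 8, 9, 10, 11])"
    by (rule zero_sum_array_rows[of "[
      [4, 2, 0, -2, -4, -1, 1], [5, 6, 7, 8, -5, -10, -11], [-9, -8, -7, -6, 9, 11, 10]]"])
     (auto simp: upt_rec)
  moreover have "base_set 4 2 1 \<subseteq> set [0..11] - {3}" by (auto simp: base_set_def)
  then have "base_set 4 2 1 \<subseteq> set [0, 1, 2, 4, 5, 6, 7, 8, 9, 10, 11]"
    by (simp add: upto.simps del: set_upto) blast
  ultimately show ?thesis by (rule zero_sum_array_mono)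
qed

text \<open>The other exceptional base, which is the whole 3 by 5 rectangle.\<close>

lemma zero_sum_array_base_1_1: "zero_sum_array 3 5 (base_set 2 1 1)"
proof -
  have "zero_sum_array 3 5 (set [0..7])"
    by (rule zero_sum_array_rows[of "[
      [2, -4, -3, -1, 6], [3, 4, -2, -6, 1], [-5, 0, 5, 7, -7]]"])
     (auto simp: upt_rec upto.simps simp del: set_upto)
  moreover have "base_set 2 1 1 \<subseteq> set [0..7]" by (auto simp: base_set_def)
  ultimately show ?thesis by (rule zero_sum_array_mono)
qed

text \<open>
  The small numbers \<open>1, \<dots>, n + r\<close> consist of the \<open>n\<close> differences of the base and of \<open>a, a + 2, \<dots>\<close>, one
  for each of the \<open>r\<close> two-row strips; their parity is forced by \<open>balanced_signs\<close>.
\<close>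

lemma zero_sum_array_odd_assembly:
  fixes a :: int and r s s' :: nat
  defines "n \<equiv> s + s'"
  assumes base: "zero_sum_array 3 (2 * n + 1) (base_set (int (n + r)) s s')"
    and a: "0 \<le> a" "a + 2 * int r \<le> 2 * int n + 2" "even (a - int n)"
    and small: "\<And>x. \<lbrakk>0 \<le> x; x \<le> int (n + r); \<not> (even x \<and> x \<le> 2 * int s); \<not> (odd x \<and> x < 2 * int s')\<rbrakk>
      \<Longrightarrow> a \<le> x \<and> x < a + 2 * int r \<and> even (x - a)"
  shows "zero_sum_array (2 * r + 3) (2 * n + 1) {0..int (3 * n + r + 1 + 2 * n * r)}"
proof -
  \<comment> \<open>\<open>f\<close> is the largest element of the base set. Strip \<open>k\<close>
    takes the \<open>k\<close>-th block of \<open>2 * n\<close> integers above \<open>f\<close>,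
    balanced by the small number \<open>a + 2 * k\<close>.\<close>
  define f where "f = int (3 * n + r + 1)"
  define Z where "Z k = insert (a + 2 * int k) {f + 2 * int n * int k<..f + 2 * int n * int k + 2 * int n}" for k
  have "zero_sum_array 2 (2 * n + 1) (Z k)" if "k < r" for k
    unfolding Z_def using a that by (intro zero_sum_array_run) (auto simp: f_def)
  then have "zero_sum_array (r * 2 + 3) (2 * n + 1) ((\<Union>k<r. Z k) \<union> base_set (int (n + r)) s s')"
    by (intro zero_sum_array_vstack zero_sum_array_vstack_UN base) simp
  moreover have "x \<in> (\<Union>k<r. Z k) \<union> base_set (int (n + r)) s s'"
    if x: "0 \<le> x" "x \<le> int (3 * n + r + 1 + 2 * n * r)" for x
  proof -
    consider "x \<in> base_set (int (n + r)) s s'" | "x \<le> int (n + r)" "x \<notin> base_set (int (n + r)) s s'" | "f < x"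
      using x(1) by (cases "x \<le> int (n + r)"; cases "f < x") (auto simp: base_set_def f_def n_def)
    then show ?thesis
    proof cases
      case 2
      then have "a \<le> x \<and> x < a + 2 * int r \<and> even (x - a)"
        using x(1) by (intro small) (auto simp: base_set_def)
      then have "nat ((x - a) div 2) < r" "x = a + 2 * int (nat ((x - a) div 2))" by auto
      then show ?thesis unfolding Z_def by blast
    next
      case 3
      define k where "k = (x - f - 1) div (2 * int n)"
      have n: "n > 0"
        using 3 x(2) by (cases n) (auto simp: f_def)
      then have "(x - f - 1) mod (2 * int n) < 2 * int n" "0 \<le> (x - f - 1) mod (2 * int n)" by simp_all
      moreover have "2 * int n * k + (x - f - 1) mod (2 * int n) = x - f - 1"
        unfolding k_def by (rule mult_div_mod_eq)
      ultimately have k: "2 * int n * k \<le> x - f - 1" "x - f - 1 < 2 * int n * k + 2 * int n"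
        by linarith+
      have "0 \<le> k" using 3 n by (simp add: k_def pos_imp_zdiv_nonneg_iff)
      moreover have "2 * int n * k < 2 * int n * int r"
        using k(1) x(2) unfolding f_def by simp
      ultimately have "nat k < r" "x \<in> Z (nat k)"
        using n k by (auto simp: Z_def)
      then show ?thesis by blast
    qed blast
  qed
  ultimately have "zero_sum_array (r * 2 + 3) (2 * n + 1) {0..int (3 * n + r + 1 + 2 * n * r)}"
    by (meson atLeastAtMost_iff subsetI zero_sum_array_mono)
  then show ?thesis by (simp add: mult.commute)
qed

text \<open>The strips receive the \<open>r\<close> largest numbers up to \<open>n + r\<close> that
  have the parity of \<open>n\<close>; the other positive ones become the differences of the
  base.\<close>

lemma zero_sum_array_odd:
  assumes "r + 2 \<le> n"
  shows "zero_sum_array (2 * r + 3) (2 * n + 1) {0..int (3 * n + r + 1 + 2 * n * r)}"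
proof -
  \<comment> \<open>\<open>u\<close> counts the positive even numbers up to \<open>n + r\<close>.
    For even \<open>n\<close> the \<open>r\<close> largest of them are given to the strips; for odd
    \<open>n\<close> all of them stay in the base.\<close>
  define u where "u = (n + r) div 2"
  define s where "s = (if even n then u - r else u)"
  define s' where "s' = n - s"
  define a where "a = (if even n then 2 * int s + 2 else 2 * int s' + 1)"
  have u: "2 * u \<le> n + r" "n + r \<le> 2 * u + 1" unfolding u_def by simp_all
  have n: "n = s + s'" using assms u by (auto simp: s_def s'_def)
  have base: "zero_sum_array 3 (2 * n + 1) (base_set (int (n + r)) s s')"
  proof -
    \<comment> \<open>For even \<open>n\<close>, \<open>s' < 2\<close> happens only at
      \<open>n = 2\<close>, \<open>r = 0\<close>. For odd \<open>n\<close> it forces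
      \<open>n = r + 2\<close>, so \<open>s = n - 1\<close>, which is at least 3 unless
      \<open>n = 3\<close>.\<close>
    consider "1 \<le> s" "2 \<le> s'" | "3 \<le> s" | "n = 3" "r = 1" "s = 2" "s' = 1"
      | "n = 2" "r = 0" "s = 1" "s' = 1"
    proof (cases "even n")
      case True
      then have "s = u - r" by (simp add: s_def)
      then have "2 \<le> s' \<or> n = 2 \<and> r = 0 \<and> s = 1 \<and> s' = 1" "1 \<le> s" using assms u n by linarith+
      then show ?thesis using that by blast
    next
      case False
      then have "s = u" by (simp add: s_def)
      then have "2 \<le> s' \<or> n = r + 2 \<and> s' = 1" "1 \<le> s" using assms u n by linarith+
      moreover have "3 \<le> s \<or> n = 3 \<and> r = 1 \<and> s = 2" if nr: "n = r + 2" "s' = 1"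
      proof -
        obtain h where "n = 2 * h + 1" using False by (elim oddE)
        then show ?thesis using nr n u \<open>s = u\<close> assms by presburger
      qed
      ultimately show ?thesis using that by blast
    qed
    then show ?thesis
    proof cases
      case 1
      then show ?thesis using zero_sum_array_base_1_2 n by simp
    next
      case 2
      then show ?thesis using zero_sum_array_base_3 n by simp
    next
      case 3
      then show ?thesis using zero_sum_array_base_2_1 by simp
    next
      case 4
      then show ?thesis using zero_sum_array_base_1_1 by simp
    qed
  qed
  have su: "int s + int r = int u" if "even n" using that assms u by (simp add: s_def)
  have su': "s = u" if "odd n" using that by (simp add: s_def)
  have n': "int n = int s + int s'" unfolding n by simp
  have u': "2 * int u \<le> int n + int r" "int n + int r \<le> 2 * int u + 1" using u by linarith+
  have a: "0 \<le> a \<and> even (a - int n) \<and> a + 2 * int r \<le> 2 * int n + 2"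
  proof (cases "even n")
    case True
    then have a: "a = 2 * int s + 2" by (simp add: a_def)
    have "even (a - int n)" using True unfolding a by simp
    then show ?thesis using su[OF True] u' assms a by linarith
  next
    case False
    then have a: "a = 2 * int s' + 1" by (simp add: a_def)
    have "even (a - int n)" using False unfolding a by simp
    then show ?thesis using su'[OF False] n' u' assms a by linarith
  qed
  have "a \<le> x \<and> x < a + 2 * int r \<and> even (x - a)"
    if x: "0 \<le> x" "x \<le> int (n + r)" "\<not> (even x \<and> x \<le> 2 * int s)" "\<not> (odd x \<and> x < 2 * int s')" for x
  proof (cases "even x")
    case True
    then obtain y where y: "x = 2 * y" by blast
    have sy: "int s < y" using True x(3) unfolding y by simp
    have "x \<le> int n + int r" using x(2) by simp
    have "even n"
    proof (rule ccontr)
      assume "odd n"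
      from su'[OF this] show False using u' \<open>x \<le> int n + int r\<close> y sy by linarith
    qed
    then have "a = 2 * int s + 2" by (simp add: a_def)
    moreover from this have "even (x - a)" unfolding y by simp
    ultimately show ?thesis using su[OF \<open>even n\<close>] u' \<open>x \<le> int n + int r\<close> y sy by linarith
  next
    case False
    then obtain y where y: "x = 2 * y + 1" by (elim oddE)
    have sy: "int s' \<le> y" using False x(4) unfolding y by simp
    have "x \<le> int n + int r" using x(2) by simp
    have "odd n"
    proof
      assume "even n"
      from su[OF this] show False using n' u' \<open>x \<le> int n + int r\<close> y sy by linarith
    qed
    then have "a = 2 * int s' + 1" by (simp add: a_def)
    moreover from this have "even (x - a)" unfolding y by simp
    ultimately show ?thesis using su'[OF \<open>odd n\<close>] n' u' \<open>x \<le> int n + int r\<close> y sy by linarith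
  qed
  then show ?thesis
    using zero_sum_array_odd_assembly[of s s' r a, folded n] a base by blast
qed

section \<open>Magic rectangles\<close>

text \<open>For odd \<open>p * q\<close> the centred labels are integers already; doubling fits them
  to \<open>centred_set\<close>, which serves both parities.\<close>

lemma zero_sum_array_double:
  assumes "zero_sum_array p q A"
  shows "zero_sum_array p q ((*) 2 ` A)"
proof -
  obtain M where M: "\<forall>i<p. (\<Sum>j<q. M i j) = 0" "\<forall>j<q. (\<Sum>i<p. M i j) = 0"
    "\<forall>x. \<bar>x\<bar> \<in> A \<longrightarrow> (\<exists>i<p. \<exists>j<q. M i j = x)"
    using assms unfolding zero_sum_array_def by blast
  have "\<exists>i<p. \<exists>j<q. 2 * M i j = x" if x: "\<bar>x\<bar> \<in> (*) 2 ` A" for x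
  proof -
    obtain z where z: "\<bar>x\<bar> = 2 * z" using x by blast
    have "even \<bar>x\<bar>" unfolding z by simp
    then have "even x" by simp
    then obtain y where y: "x = 2 * y" by blast
    then have "\<bar>y\<bar> \<in> A" using x by (auto simp: abs_mult)
    then show ?thesis using M(3) y by blast
  qed
  moreover have "(\<Sum>j<q. 2 * M i j) = 0" if "i < p" for i
    using M(1) that by (simp flip: sum_distrib_left)
  moreover have "(\<Sum>i<p. 2 * M i j) = 0" if "j < q" for j
    using M(2) that by (simp flip: sum_distrib_left)
  ultimately show ?thesis
    unfolding zero_sum_array_def by (intro exI[of _ "\<lambda>i j. 2 * M i j"]) blast
qed

text \<open>The absolute values of \<open>2 * l - (k - 1)\<close> for labels \<open>l < k\<close>;
  the factor 2 keeps centred labels integral for even \<open>k\<close>.\<close>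

definition centred_set :: "nat \<Rightarrow> int set" where
  "centred_set k = {x. 0 \<le> x \<and> x < int k \<and> (even x \<longleftrightarrow> odd k)}"

lemma zero_sum_array_full_odd:
  assumes "odd p" "odd q" "2 < p" "p < q"
  shows "zero_sum_array p q (centred_set (p * q))"
proof -
  obtain b where "p = 2 * b + 1" using assms(1) by (elim oddE)
  then obtain r where r: "p = 2 * r + 3" using assms(3) by (intro that[of "b - 1"]) simp
  obtain n where n: "q = 2 * n + 1" using assms(2) by (elim oddE)
  have "zero_sum_array p q ((*) 2 ` {0..int (3 * n + r + 1 + 2 * n * r)})"
    unfolding r n using assms r n by (intro zero_sum_array_double zero_sum_array_odd) simp
  moreover have "centred_set (p * q) \<subseteq> (*) 2 ` {0..int (3 * n + r + 1 + 2 * n * r)}"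
  proof
    fix x assume x: "x \<in> centred_set (p * q)"
    then have "even x" using assms by (simp add: centred_set_def)
    then obtain y where y: "x = 2 * y" by blast
    have "int (p * q) = 2 * int (3 * n + r + 1 + 2 * n * r) + 1"
      unfolding r n by (simp add: algebra_simps)
    then have "y \<in> {0..int (3 * n + r + 1 + 2 * n * r)}"
      using x y unfolding centred_set_def by simp
    then show "x \<in> (*) 2 ` {0..int (3 * n + r + 1 + 2 * n * r)}" unfolding y by (rule imageI)
  qed
  ultimately show ?thesis by (rule zero_sum_array_mono)
qed

lemma zero_sum_array_full:
  assumes "even p \<longleftrightarrow> even q" "2 < p" "2 < q" "p \<noteq> q"
  shows "zero_sum_array p q (centred_set (p * q))"
proof (cases "even p")
  case True
  then have "even q" using assms(1) by simp
  have "centred_set (p * q) \<subseteq> odds 0 (p * q div 2)"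
  proof
    fix x assume x: "x \<in> centred_set (p * q)"
    then have "odd x" using True by (simp add: centred_set_def)
    then obtain y where y: "x = 2 * y + 1" by (elim oddE)
    have "p * q = 2 * (p * q div 2)" using True by simp
    then have "int (p * q) = 2 * int (p * q div 2)" by linarith
    then have "0 \<le> y" "y < int (p * q div 2)" using x y unfolding centred_set_def by auto
    then show "x \<in> odds 0 (p * q div 2)" unfolding y by (intro image_eqI[of _ _ "nat y"]) auto
  qed
  then show ?thesis using zero_sum_array_even[OF True \<open>even q\<close>] assms zero_sum_array_mono by blast
next
  case False
  \<comment> \<open>The odd construction has fewer rows than columns; transposition gives the other
    order.\<close>
  then show ?thesis
    using zero_sum_array_full_odd[of p q] zero_sum_array_full_odd[of q p] assms
      zero_sum_array_transpose by (metis linorder_neqE_nat mult.commute)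
qed

text \<open>The \<open>p * q\<close> cells of \<open>M\<close> attain all \<open>p * q\<close>
  values \<open>t l\<close>, so by counting each is attained exactly once and nothing else occurs.
  Undoing the centring \<open>t\<close> turns zero sums into equal line sums.\<close>

lemma magic_rectangle_exists:
  assumes "even p \<longleftrightarrow> even q" "2 < p" "2 < q" "p \<noteq> q"
  obtains N :: "nat \<Rightarrow> nat \<Rightarrow> nat" where
    "bij_betw (\<lambda>(i, j). N i j) ({..<p} \<times> {..<q}) {..<p * q}"
    "\<And>i. i < p \<Longrightarrow> 2 * (\<Sum>j<q. N i j) = q * (p * q - 1)"
    "\<And>j. j < q \<Longrightarrow> 2 * (\<Sum>i<p. N i j) = p * (p * q - 1)"
proof -
  obtain M where M: "\<forall>i<p. (\<Sum>j<q. M i j) = 0" "\<forall>j<q. (\<Sum>i<p. M i j) = 0"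
    "\<forall>x. \<bar>x\<bar> \<in> centred_set (p * q) \<longrightarrow> (\<exists>i<p. \<exists>j<q. M i j = x)"
    using zero_sum_array_full[OF assms] unfolding zero_sum_array_def by blast
  define t :: "nat \<Rightarrow> int" where "t l = 2 * int l - int (p * q - 1)" for l
  have pq: "p * q > 0" using assms by simp
  let ?D = "{..<p} \<times> {..<q}" and ?M = "\<lambda>(i, j). M i j"
  have inj_t: "inj t" unfolding t_def by (intro injI) simp
  have sub: "t ` {..<p * q} \<subseteq> ?M ` ?D"
  proof
    fix x assume "x \<in> t ` {..<p * q}"
    then obtain l where l: "l < p * q" "x = t l" by auto
    have "int (p * q - 1) = int (p * q) - 1" using pq by (simp add: of_nat_diff)
    then have x: "x = 2 * int l + 1 - int (p * q)" using l(2) by (simp add: t_def)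
    have "\<bar>x\<bar> < int (p * q)" using l(1) unfolding x by linarith
    moreover have "even x \<longleftrightarrow> odd (p * q)" unfolding x by simp
    ultimately have "\<bar>x\<bar> \<in> centred_set (p * q)" by (simp add: centred_set_def)
    then show "x \<in> ?M ` ?D" using M(3) by force
  qed
  have card_t: "card (t ` {..<p * q}) = p * q"
    using inj_t by (simp add: card_image inj_on_subset)
  have "card (?M ` ?D) \<le> p * q" using card_image_le[of ?D ?M] by simp
  with sub card_t have eq: "?M ` ?D = t ` {..<p * q}"
    by (intro card_seteq[symmetric]) auto
  have inj: "inj_on ?M ?D"
    by (rule eq_card_imp_inj_on) (simp_all add: eq card_t)
  define N where "N i j = the_inv t (M i j)" for i j
  have tN: "t (N i j) = M i j" if "i < p" "j < q" for i j
  proof -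
    have "M i j \<in> ?M ` ?D" using that by force
    then have "M i j \<in> range t" unfolding eq by auto
    then show ?thesis unfolding N_def by (rule f_the_inv_into_f[OF inj_t])
  qed
  show thesis
  proof
    have "bij_betw (the_inv t \<circ> ?M) ?D {..<p * q}"
    proof (rule bij_betw_trans)
      show "bij_betw ?M ?D (t ` {..<p * q})" using inj eq by (simp add: bij_betw_def)
      have "bij_betw t {..<p * q} (t ` {..<p * q})"
        using inj_t by (auto simp: bij_betw_def intro: inj_on_subset)
      then show "bij_betw (the_inv t) (t ` {..<p * q}) {..<p * q}"
        using inj_t by (auto simp: bij_betw_def inj_on_def image_image the_inv_f_f)
    qed
    then show "bij_betw (\<lambda>(i, j). N i j) ?D {..<p * q}"
      by (simp add: N_def comp_def case_prod_unfold)
  next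
    fix i assume "i < p"
    then have "(\<Sum>j<q. t (N i j)) = 0" using M(1) tN by simp
    then have "int (2 * (\<Sum>j<q. N i j)) = int (q * (p * q - 1))"
      by (simp add: t_def sum_subtractf sum_distrib_left)
    then show "2 * (\<Sum>j<q. N i j) = q * (p * q - 1)" by (simp only: of_nat_eq_iff)
  next
    fix j assume "j < q"
    then have "(\<Sum>i<p. t (N i j)) = 0" using M(2) tN by simp
    then have "int (2 * (\<Sum>i<p. N i j)) = int (p * (p * q - 1))"
      by (simp add: t_def sum_subtractf sum_distrib_left)
    then show "2 * (\<Sum>i<p. N i j) = p * (p * q - 1)" by (simp only: of_nat_eq_iff)
  qed
qed

section \<open>Moving the entry 0 to a prescribed cell\<close>

lemma bij_betw_pointed:
  assumes "finite A" "finite B" "card A = card B" "a \<in> A" "b \<in> B"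
  obtains f where "bij_betw f A B" "f a = b"
proof -
  have "card (A - {a}) = card (B - {b})" using assms by simp
  then obtain g where g: "bij_betw g (A - {a}) (B - {b})"
    using assms(1,2) by (meson finite_Diff finite_same_card_bij)
  have "bij_betw (g(a := b)) (A - {a}) (B - {b})"
    using g by (rule bij_betw_cong[THEN iffD1, rotated]) simp
  then have "bij_betw (g(a := b)) (insert a (A - {a})) (insert b (B - {b}))"
    by (subst insert_is_Un, subst (2) insert_is_Un, intro bij_betw_combine) auto
  then show ?thesis using that[of "g(a := b)"] assms(4,5) by (simp add: insert_absorb)
qed

text \<open>Permuting rows and columns preserves the line sums, so the row and column of the entry 0
  can be sent to \<open>a\<close> and \<open>b\<close>.\<close>

lemma magic_rectangle_pointed:
  fixes X :: "'a set" and Y :: "'b set"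
  assumes "finite X" "finite Y" "card X = p" "card Y = q" "a \<in> X" "b \<in> Y"
    and "even p \<longleftrightarrow> even q" "2 < p" "2 < q" "p \<noteq> q"
  obtains N :: "'a \<Rightarrow> 'b \<Rightarrow> nat" where
    "bij_betw (\<lambda>(x, y). N x y) (X \<times> Y) {..<p * q}" "N a b = 0"
    "\<And>x. x \<in> X \<Longrightarrow> 2 * (\<Sum>y\<in>Y. N x y) = q * (p * q - 1)"
    "\<And>y. y \<in> Y \<Longrightarrow> 2 * (\<Sum>x\<in>X. N x y) = p * (p * q - 1)"
proof -
  obtain N where N: "bij_betw (\<lambda>(i, j). N i j) ({..<p} \<times> {..<q}) {..<p * q}"
    "\<And>i. i < p \<Longrightarrow> 2 * (\<Sum>j<q. N i j) = q * (p * q - 1)"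
    "\<And>j. j < q \<Longrightarrow> 2 * (\<Sum>i<p. N i j) = p * (p * q - 1)"
    using magic_rectangle_exists[OF assms(7-10)] by blast
  have "0 \<in> (\<lambda>(i, j). N i j) ` ({..<p} \<times> {..<q})"
    using N(1) assms(8,9) by (simp add: bij_betw_imp_surj_on)
  then obtain i j where ij: "i < p" "j < q" "N i j = 0" by force
  obtain g where g: "bij_betw g X {..<p}" "g a = i"
    using bij_betw_pointed[of X "{..<p}" a i] assms ij by auto
  obtain h where h: "bij_betw h Y {..<q}" "h b = j"
    using bij_betw_pointed[of Y "{..<q}" b j] assms ij by auto
  show thesis
  proof
    have "bij_betw (map_prod g h) (X \<times> Y) ({..<p} \<times> {..<q})"
      using g(1) h(1) by (rule bij_betw_map_prod)
    from bij_betw_trans[OF this N(1)]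
    show "bij_betw (\<lambda>(x, y). N (g x) (h y)) (X \<times> Y) {..<p * q}"
      by (simp add: comp_def case_prod_unfold)
    show "N (g a) (h b) = 0" using g h ij by simp
  next
    fix x assume "x \<in> X"
    then have "g x < p" using g(1) by (auto simp: bij_betw_def)
    then show "2 * (\<Sum>y\<in>Y. N (g x) (h y)) = q * (p * q - 1)"
      using N(2) sum.reindex_bij_betw[OF h(1), of "N (g x)"] by simp
  next
    fix y assume "y \<in> Y"
    then have "h y < q" using h(1) by (auto simp: bij_betw_def)
    then show "2 * (\<Sum>x\<in>X. N (g x) (h y)) = p * (p * q - 1)"
      using N(3) sum.reindex_bij_betw[OF g(1), of "\<lambda>i. N i (h y)"] by simp
  qed
qed

section \<open>The labeling\<close>

lemma chi_la_ge_3: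
  assumes "finite V" "{a, b} \<in> E" "{a, c} \<in> E" "{b, c} \<in> E" "a \<in> V" "b \<in> V" "c \<in> V"
  shows "3 \<le> chi_la V E"
  unfolding chi_la_def
proof (rule INF_greatest)
  fix f assume "f \<in> {f. local_antimagic_labeling E f}"
  then have "card {weight E f a, weight E f b, weight E f c} = 3"
    using assms unfolding local_antimagic_labeling_def by auto
  moreover have "card {weight E f a, weight E f b, weight E f c} \<le> card (weight E f ` V)"
    using assms by (intro card_mono) auto
  ultimately have "3 \<le> card (weight E f ` V)" by linarith
  then show "3 \<le> enat (card (weight E f ` V))" by (simp add: numeral_eq_enat)
qed

theorem theorem2p6:
  fixes m n :: nat and V :: "'a set" and E :: "'a set set"
  assumes "m \<ge> 2" and "n \<ge> 2" and "[m = n] (mod 2)" and "m \<noteq> n"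
    and "complete_tripartite 1 m n V E"
  shows "chi_la V E = 3"
proof -
  obtain A B C where fin: "finite A" "finite B" "finite C"
    and card: "card A = 1" "card B = m" "card C = n"
    and disj: "A \<inter> B = {}" "A \<inter> C = {}" "B \<inter> C = {}" and V: "V = A \<union> B \<union> C"
    and E: "E = {{u, v} | u v. u \<in> A \<and> v \<in> B \<or> u \<in> A \<and> v \<in> C \<or> u \<in> B \<and> v \<in> C}"
    using assms(5) unfolding complete_tripartite_def by (elim exE conjE)
  obtain a where A: "A = {a}" using card(1) by (auto simp: card_1_singleton_iff)
  have aB: "a \<notin> B" and aC: "a \<notin> C" using disj A by auto
  define X where "X = insert a B"
  define Y where "Y = insert a C"
  \<comment> \<open>\<open>k\<close> is both the largest entry of the rectangle and the number of
    edges.\<close>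
  define k where "k = (m + 1) * (n + 1) - 1"
  have k: "k > 0" "(m + 1) * (n + 1) = Suc k" using assms(1) by (simp_all add: k_def)
  have "even (m + 1) \<longleftrightarrow> even (n + 1)" using assms(3) unfolding cong_def by presburger
  moreover have "finite X" "finite Y" "card X = m + 1" "card Y = n + 1" "a \<in> X" "a \<in> Y"
    using fin card aB aC by (simp_all add: X_def Y_def)
  ultimately obtain N where N: "bij_betw (\<lambda>(x, y). N x y) (X \<times> Y) {..<Suc k}" "N a a = 0"
    and row: "\<And>x. x \<in> X \<Longrightarrow> 2 * (\<Sum>y\<in>Y. N x y) = (n + 1) * k"
    and col: "\<And>y. y \<in> Y \<Longrightarrow> 2 * (\<Sum>x\<in>X. N x y) = (m + 1) * k"
    using magic_rectangle_pointed[of X Y "m + 1" "n + 1" a a] assms(1,2,4) k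
    unfolding k_def by auto
  define D where "D = X \<times> Y - {(a, a)}"
  define F :: "'a \<times> 'a \<Rightarrow> 'a set" where "F = (\<lambda>(u, v). {u, v})"
  have F: "bij_betw F D E"
  proof (rule bij_betw_imageI)
    \<comment> \<open>Forgetting the order loses nothing: \<open>B\<close> and \<open>C\<close> are
      disjoint, \<open>a\<close> lies in neither, and \<open>(a, a)\<close> is excluded.\<close>
    show "inj_on F D"
      using disj aB aC by (auto simp: inj_on_def F_def D_def X_def Y_def doubleton_eq_iff)
    show "F ` D = E"
    proof
      show "F ` D \<subseteq> E"
        by (auto simp: F_def D_def X_def Y_def E A insert_commute)
      show "E \<subseteq> F ` D"
      proof
        fix e assume "e \<in> E"
        then consider v where "e = {a, v}" "v \<in> B" | v where "e = {a, v}" "v \<in> C"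
          | u v where "e = {u, v}" "u \<in> B" "v \<in> C" unfolding E A by blast
        then show "e \<in> F ` D"
        proof cases
          case (1 v)
          then show ?thesis using aB
            by (intro image_eqI[of _ _ "(v, a)"]) (auto simp: F_def D_def X_def Y_def)
        next
          case (2 v)
          then show ?thesis using aC
            by (intro image_eqI[of _ _ "(a, v)"]) (auto simp: F_def D_def X_def Y_def)
        next
          case (3 u v)
          then show ?thesis using aB
            by (intro image_eqI[of _ _ "(u, v)"]) (auto simp: F_def D_def X_def Y_def)
        qed
      qed
    qed
  qed
  define f where "f = (\<lambda>(x, y). N x y) \<circ> inv_into D F"
  have sum_f: "sum f (F ` S) = (\<Sum>(x, y)\<in>S. N x y)" if "S \<subseteq> D" for S
  proof -
    have "inj_on F S" using F that by (meson bij_betw_imp_inj_on inj_on_subset)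
    then have "sum f (F ` S) = (\<Sum>s\<in>S. f (F s))" by (simp add: sum.reindex)
    also have "\<dots> = (\<Sum>(x, y)\<in>S. N x y)"
      using that F by (intro sum.cong) (auto simp: f_def bij_betw_inv_into_left)
    finally show ?thesis .
  qed
  have f: "bij_betw f E {1..card E}"
  proof -
    \<comment> \<open>Deleting the cell \<open>(a, a)\<close> deletes exactly the label 0.\<close>
    have "bij_betw (\<lambda>(x, y). N x y) D ({..<Suc k} - {0})"
      unfolding D_def using N by (intro bij_betw_DiffI[OF N(1)]) (auto simp: bij_betw_def X_def Y_def)
    also have "{..<Suc k} - {0} = {1..k}" by auto
    finally have bij: "bij_betw (\<lambda>(x, y). N x y) D {1..k}" .
    then have "bij_betw f E {1..k}"
      unfolding f_def using bij_betw_inv_into[OF F] by (rule bij_betw_trans[rotated])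
    moreover from this have "card E = k" using bij_betw_same_card by fastforce
    ultimately show ?thesis by simp
  qed
  have wB: "2 * weight E f b = (n + 1) * k" if "b \<in> B" for b
  proof -
    have "b \<noteq> a" "b \<notin> C" using that aB disj by auto
    then have "incident_edges E b = F ` ({b} \<times> Y)"
      using that by (auto simp: incident_edges_def E A F_def Y_def)
    then have "weight E f b = (\<Sum>(x, y)\<in>{b} \<times> Y. N x y)"
      unfolding weight_def using sum_f[of "{b} \<times> Y"] that aB by (auto simp: D_def X_def)
    also have "\<dots> = (\<Sum>y\<in>Y. N b y)" by (simp flip: sum.cartesian_product)
    finally show ?thesis using row[of b] that by (simp add: X_def)
  qed
  have wC: "2 * weight E f c = (m + 1) * k" if "c \<in> C" for c
  proof -
    have "c \<noteq> a" "c \<notin> B" using that aC disj by auto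
    then have "incident_edges E c = F ` (X \<times> {c})"
      using that by (auto simp: incident_edges_def E A F_def X_def)
    then have "weight E f c = (\<Sum>(x, y)\<in>X \<times> {c}. N x y)"
      unfolding weight_def using sum_f[of "X \<times> {c}"] that aC by (auto simp: D_def Y_def)
    also have "\<dots> = (\<Sum>x\<in>X. N x c)" by (simp flip: sum.cartesian_product)
    finally show ?thesis using col[of c] that by (simp add: Y_def)
  qed
  have wa: "2 * weight E f a = (n + 1) * k + (m + 1) * k"
  proof -
    have "incident_edges E a = F ` ({a} \<times> C \<union> B \<times> {a})"
      using aB aC by (auto simp: incident_edges_def E A F_def)
    then have "weight E f a = (\<Sum>(x, y)\<in>{a} \<times> C \<union> B \<times> {a}. N x y)"
      unfolding weight_def using sum_f[of "{a} \<times> C \<union> B \<times> {a}"] aB aC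
      by (auto simp: D_def X_def Y_def)
    also have "\<dots> = (\<Sum>(x, y)\<in>{a} \<times> C. N x y) + (\<Sum>(x, y)\<in>B \<times> {a}. N x y)"
      using fin aB by (intro sum.union_disjoint) auto
    also have "\<dots> = (\<Sum>y\<in>C. N a y) + (\<Sum>x\<in>B. N x a)" by (simp flip: sum.cartesian_product)
    \<comment> \<open>The entry 0 at \<open>(a, a)\<close> can be added to both sums, completing row
      \<open>a\<close> and column \<open>a\<close>.\<close>
    also have "\<dots> = (\<Sum>y\<in>Y. N a y) + (\<Sum>x\<in>X. N x a)"
      using fin aB aC N(2) by (simp add: X_def Y_def)
    finally show ?thesis using row[of a] col[of a] by (simp add: X_def Y_def)
  qed
  have ne: "(n + 1) * k \<noteq> (m + 1) * k" "(n + 1) * k + (m + 1) * k \<noteq> (n + 1) * k"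
    "(n + 1) * k + (m + 1) * k \<noteq> (m + 1) * k"
    using assms(4) k(1) by simp_all
  have "local_antimagic_labeling E f"
    unfolding local_antimagic_labeling_def
  proof (intro conjI allI impI f)
    fix u v assume "{u, v} \<in> E"
    then have "u = a \<and> v \<in> B \<or> v = a \<and> u \<in> B \<or> u = a \<and> v \<in> C \<or> v = a \<and> u \<in> C \<or>
        u \<in> B \<and> v \<in> C \<or> v \<in> B \<and> u \<in> C"
      unfolding E A by (auto simp: doubleton_eq_iff)
    then have "2 * weight E f u \<noteq> 2 * weight E f v"
      using ne wa wB wC by metis
    then show "weight E f u \<noteq> weight E f v" by simp
  qed
  moreover have "card (weight E f ` V) \<le> 3"
  proof -
    have "weight E f b = (n + 1) * k div 2" if "b \<in> B" for b
      using wB[OF that] by linarith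
    moreover have "weight E f c = (m + 1) * k div 2" if "c \<in> C" for c
      using wC[OF that] by linarith
    ultimately have "weight E f ` V \<subseteq> {weight E f a, (n + 1) * k div 2, (m + 1) * k div 2}"
      unfolding V A by blast
    then have "card (weight E f ` V) \<le> card {weight E f a, (n + 1) * k div 2, (m + 1) * k div 2}"
      by (intro card_mono) auto
    also have "\<dots> \<le> 3" by (simp add: card_insert_if)
    finally show ?thesis .
  qed
  ultimately have "chi_la V E \<le> 3"
    unfolding chi_la_def by (intro INF_lower2[of f]) (simp_all add: numeral_eq_enat)
  moreover have "3 \<le> chi_la V E"
  proof -
    obtain b c where "b \<in> B" "c \<in> C" using card assms(1,2) by (metis card.empty ex_in_conv not_numeral_le_zero)
    then show ?thesis
      using fin by (intro chi_la_ge_3[of V a b E c]) (auto simp: V E A)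
  qed
  ultimately show ?thesis by (rule antisym)
qed

end
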